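(* Let $S$ be a finite non-empty set, let $f\colon 2^S\to[0,\infty)$ be non-decreasing and submodular with $f(\emptyset)=0$ and $f(A)>0$ for all $A\neq\emptyset$, and let $g\colon 2^S\to[0,\infty)$ be non-decreasing and supermodular with $g(\emptyset)=0$ and $g(A)<g(S)$ for all $A\neq S$. Let $A_1,\dots,A_k$ be a generalized Sidney decomposition of $S$ with respect to $f$ and $g$. Then any search $\pi$ of $S$ that respects the ordering $A_1,\dots,A_k$ (that is, for $i<j$, all elements of $A_i$ precede all elements of $A_j$ in $\pi$) approximates an optimal search by a factor of $2$: $c(\pi)\le 2\min_\sigma c(\sigma)$.
   Context: A search is a permutation $\pi$ of $S$. For $j\in S$, $S_j^\pi$ is the set consisting of $j$ and all elements preceding $j$ in $\pi$, and $c(\pi)=\sum_{j\in S}\bigl(g(S_j^\pi)-g(S_j^\pi\setminus\{j\})\bigr)f(S_j^\pi)$; the minimum is over all permutations $\sigma$ of $S$. For $A\subseteq S$ and $B\subseteq S\setminus A$, the contractions are $f_A(B)=f(A\cup B)-f(A)$ and $g_A(B)=g(A\cup B)-g(A)$. A generalized Sidney decomposition is a partition of $S$ into non-empty sets $A_1,\dots,A_k$ such that for each $i$, writing $A^{i-1}=A_1\cup\dots\cup A_{i-1}$ (with $A^0=\emptyset$), the set $A_i$ has maximum density in the contracted problem, i.e. $f_{A^{i-1}}(A_i)>0$ and $A_i$ maximizes $g_{A^{i-1}}(B)/f_{A^{i-1}}(B)$ over all $B\subseteq S\setminus A^{i-1}$ with $f_{A^{i-1}}(B)>0$. *)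

theory Defs
  imports
    Complex_Main
    "HOL-Library.Disjoint_Sets"
    "HOL-Combinatorics.Multiset_Permutations"
begin

text \<open>
  Set functions on the subsets of \<open>S\<close> are functions \<open>'a set \<Rightarrow> real\<close>, of which only the values
  on \<open>Pow S\<close> matter. Searches are the elements of \<open>permutations_of_set S\<close>, that is, the duplicate-free
  lists that enumerate \<open>S\<close>.
\<close>

definition submodular_on :: "'a set \<Rightarrow> ('a set \<Rightarrow> real) \<Rightarrow> bool" where
  "submodular_on S f \<longleftrightarrow>
     (\<forall>A B. A \<subseteq> S \<longrightarrow> B \<subseteq> S \<longrightarrow> f (A \<union> B) + f (A \<inter> B) \<le> f A + f B)"

definition supermodular_on :: "'a set \<Rightarrow> ('a set \<Rightarrow> real) \<Rightarrow> bool" where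
  "supermodular_on S g \<longleftrightarrow>
     (\<forall>A B. A \<subseteq> S \<longrightarrow> B \<subseteq> S \<longrightarrow> g A + g B \<le> g (A \<union> B) + g (A \<inter> B))"

definition precedes :: "'a list \<Rightarrow> 'a \<Rightarrow> 'a \<Rightarrow> bool" where
  "precedes \<pi> x y \<longleftrightarrow> (\<exists>m n. m < n \<and> n < length \<pi> \<and> \<pi> ! m = x \<and> \<pi> ! n = y)"

definition searched_upto :: "'a list \<Rightarrow> 'a \<Rightarrow> 'a set" where
  "searched_upto \<pi> j = insert j {x. precedes \<pi> x j}"

definition search_cost ::
  "'a set \<Rightarrow> ('a set \<Rightarrow> real) \<Rightarrow> ('a set \<Rightarrow> real) \<Rightarrow> 'a list \<Rightarrow> real" where
  "search_cost S f g \<pi> =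
     (\<Sum>j\<in>S. (g (searched_upto \<pi> j) - g (searched_upto \<pi> j - {j})) * f (searched_upto \<pi> j))"

definition contraction :: "('a set \<Rightarrow> real) \<Rightarrow> 'a set \<Rightarrow> 'a set \<Rightarrow> real" where
  "contraction f A B = f (A \<union> B) - f A"

definition max_density ::
  "'a set \<Rightarrow> ('a set \<Rightarrow> real) \<Rightarrow> ('a set \<Rightarrow> real) \<Rightarrow> 'a set \<Rightarrow> bool" where
  "max_density T f g A \<longleftrightarrow>
     A \<subseteq> T \<and> f A > 0 \<and> (\<forall>B. B \<subseteq> T \<and> f B > 0 \<longrightarrow> g B / f B \<le> g A / f A)"

text \<open>
  The ordered partition \<open>A\<^sub>1, \<dots>, A\<^sub>k\<close> is the list \<open>As\<close>, indexed from \<open>0\<close>, so the union of the sets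
  strictly before \<open>As ! i\<close> is \<open>\<Union>(set (take i As))\<close>.
\<close>

definition sidney_decomposition ::
  "'a set \<Rightarrow> ('a set \<Rightarrow> real) \<Rightarrow> ('a set \<Rightarrow> real) \<Rightarrow> 'a set list \<Rightarrow> bool" where
  "sidney_decomposition S f g As \<longleftrightarrow>
     distinct As \<and> partition_on S (set As) \<and>
     (\<forall>i < length As. let P = \<Union>(set (take i As)) in
        max_density (S - P) (contraction f P) (contraction g P) (As ! i))"

definition respects_order :: "'a list \<Rightarrow> 'a set list \<Rightarrow> bool" where
  "respects_order \<pi> As \<longleftrightarrow>
     (\<forall>i j. i < j \<and> j < length As \<longrightarrow> (\<forall>x \<in> As ! i. \<forall>y \<in> As ! j. precedes \<pi> x y))"

end

theory Submission
  imports Defs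
begin

text \<open>
  Write \<open>P\<^sub>i = A\<^sub>1 \<union> \<dots> \<union> A\<^sub>i\<close>. The densities \<open>\<rho>\<^sub>i\<close> of the contracted problems are non-increasing, and
  by supermodularity of \<open>g - \<rho>\<^sub>i f\<close> every \<open>B \<subseteq> S\<close> satisfies
  \<open>g B - g P\<^sub>i \<le> \<rho>\<^sub>i\<^sub>+\<^sub>1 (f B - f P\<^sub>i)\<close>. So all the points \<open>(f B, g B)\<close> lie below the concave polygon
  through the points \<open>(f P\<^sub>i, g P\<^sub>i)\<close>. The cost of a search is the area under a step function in the
  \<open>g\<close>-coordinate: it is at least the area cut off by the polygon, in which the layer
  between \<open>g P\<^sub>i\<close> and \<open>g P\<^sub>i\<^sub>+\<^sub>1\<close> is a trapezium with parallel sides \<open>f P\<^sub>i\<close> and \<open>f P\<^sub>i\<^sub>+\<^sub>1\<close>. For a search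
  respecting the decomposition it is at most the sum of the rectangles of width \<open>f P\<^sub>i\<^sub>+\<^sub>1\<close>,
  and each rectangle is at most twice its trapezium.
\<close>

section \<open>Slicing a sum along a second sequence\<close>

text \<open>For \<open>a i \<le> a (Suc i)\<close> this is the length of the part of the interval
  from \<open>a i\<close> to \<open>a (Suc i)\<close> that lies below \<open>y\<close>. As a
  difference of minima it telescopes over \<open>i\<close>.\<close>

definition layer :: "(nat \<Rightarrow> real) \<Rightarrow> nat \<Rightarrow> real \<Rightarrow> real" where
  "layer a i y = min y (a (Suc i)) - min y (a i)"

lemma sum_layer:
  assumes "a 0 \<le> y" "y \<le> a k"
  shows "(\<Sum>i<k. layer a i y) = y - a 0"
  using assms sum_lessThan_telescope[of "\<lambda>i. min y (a i)" k] by (simp add: layer_def)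

lemma layer_mono: "a i \<le> a (Suc i) \<Longrightarrow> y \<le> z \<Longrightarrow> layer a i y \<le> layer a i z"
  by (auto simp: layer_def)

lemma sum_increments_conv_layers:
  fixes a u v :: "nat \<Rightarrow> real"
  assumes "\<And>n. n \<le> N \<Longrightarrow> a 0 \<le> u n" "\<And>n. n \<le> N \<Longrightarrow> u n \<le> a k"
  shows "(\<Sum>n<N. (u (Suc n) - u n) * v (Suc n)) =
    (\<Sum>i<k. \<Sum>n<N. (layer a i (u (Suc n)) - layer a i (u n)) * v (Suc n))"
proof -
  have "u (Suc n) - u n = (\<Sum>i<k. layer a i (u (Suc n)) - layer a i (u n))" if "n < N" for n
    using that assms by (simp add: sum_subtractf sum_layer)
  then have "(\<Sum>n<N. (u (Suc n) - u n) * v (Suc n)) =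
      (\<Sum>n<N. \<Sum>i<k. (layer a i (u (Suc n)) - layer a i (u n)) * v (Suc n))"
    by (simp add: sum_distrib_right)
  also have "\<dots> = (\<Sum>i<k. \<Sum>n<N. (layer a i (u (Suc n)) - layer a i (u n)) * v (Suc n))"
    by (rule sum.swap)
  finally show ?thesis .
qed

context
  fixes a b u v :: "nat \<Rightarrow> real" and k N :: nat
  assumes a_mono: "\<And>i. i < k \<Longrightarrow> a i \<le> a (Suc i)"
    and u_mono: "\<And>n. n < N \<Longrightarrow> u n \<le> u (Suc n)"
    and u_bounds: "\<And>n. n \<le> N \<Longrightarrow> a 0 \<le> u n" "\<And>n. n \<le> N \<Longrightarrow> u n \<le> a k"
    and u_ends: "u 0 = a 0" "u N = a k"
begin

lemma a_mono_le: "i \<le> j \<Longrightarrow> j \<le> k \<Longrightarrow> a i \<le> a j"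
proof (induction j rule: dec_induct)
  case (step j)
  then show ?case using a_mono[of j] by simp
qed simp

lemma layer_ends:
  assumes "i < k"
  shows "layer a i (u 0) = 0" "layer a i (u N) = a (Suc i) - a i"
  using assms a_mono_le[of 0 i] a_mono_le[of 0 "Suc i"] a_mono_le[of i k] a_mono_le[of "Suc i" k]
  by (auto simp: layer_def u_ends)

text \<open>Inside layer \<open>i\<close> the increments of \<open>u\<close> telescope to its full
  height. Those with \<open>u n \<ge> a (Suc i)\<close> vanish there, so \<open>v\<close> has to be
  bounded only at the steps that start below the top of the layer.\<close>

lemma sum_increments_le_rectangles:
  assumes "\<And>n i. n < N \<Longrightarrow> i < k \<Longrightarrow> u n < a (Suc i) \<Longrightarrow> v (Suc n) \<le> b (Suc i)"
  shows "(\<Sum>n<N. (u (Suc n) - u n) * v (Suc n)) \<le> (\<Sum>i<k. (a (Suc i) - a i) * b (Suc i))"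
proof -
  have *: "(layer a i (u (Suc n)) - layer a i (u n)) * v (Suc n)
      \<le> (layer a i (u (Suc n)) - layer a i (u n)) * b (Suc i)" if "i < k" "n < N" for i n
  proof (cases "u n < a (Suc i)")
    case True
    then show ?thesis
      using that assms layer_mono a_mono u_mono by (intro mult_left_mono) auto
  next
    case False
    then have "layer a i (u (Suc n)) = layer a i (u n)"
      using a_mono[of i] u_mono[of n] that by (auto simp: layer_def)
    then show ?thesis by simp
  qed
  have "(\<Sum>n<N. (u (Suc n) - u n) * v (Suc n)) =
      (\<Sum>i<k. \<Sum>n<N. (layer a i (u (Suc n)) - layer a i (u n)) * v (Suc n))"
    using u_bounds by (rule sum_increments_conv_layers)
  also have "\<dots> \<le> (\<Sum>i<k. \<Sum>n<N. (layer a i (u (Suc n)) - layer a i (u n)) * b (Suc i))"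
    using * by (intro sum_mono) auto
  also have "\<dots> = (\<Sum>i<k. (a (Suc i) - a i) * b (Suc i))"
  proof (intro sum.cong refl)
    fix i assume "i \<in> {..<k}"
    then show "(\<Sum>n<N. (layer a i (u (Suc n)) - layer a i (u n)) * b (Suc i))
        = (a (Suc i) - a i) * b (Suc i)"
      using sum_lessThan_telescope[of "\<lambda>n. layer a i (u n)" N] layer_ends[of i]
      by (simp flip: sum_distrib_right)
  qed
  finally show ?thesis .
qed

text \<open>In layer \<open>i\<close> the step function lies above the line through
  \<open>(a i, b i)\<close> and \<open>(a (Suc i), b (Suc i))\<close>, whose integral is the
  trapezium. The condition \<open>above_line\<close> is free of division, so layers of height 0 are
  covered.\<close>

lemma trapezia_le_sum_increments:
  assumes b_mono: "\<And>i. i < k \<Longrightarrow> b i \<le> b (Suc i)"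
    and above_line: "\<And>n i. n < N \<Longrightarrow> i < k \<Longrightarrow>
      (u (Suc n) - a i) * (b (Suc i) - b i) \<le> (a (Suc i) - a i) * (v (Suc n) - b i)"
  shows "(\<Sum>i<k. (a (Suc i) - a i) * ((b i + b (Suc i)) / 2))
    \<le> (\<Sum>n<N. (u (Suc n) - u n) * v (Suc n))"
proof -
  have "(a (Suc i) - a i) * ((b i + b (Suc i)) / 2)
      \<le> (\<Sum>n<N. (layer a i (u (Suc n)) - layer a i (u n)) * v (Suc n))" if i: "i < k" for i
  proof (cases "a (Suc i) = a i")
    case True
    then show ?thesis by (simp add: layer_def)
  next
    case False
    then have da: "a (Suc i) - a i > 0" using a_mono[OF i] by simp
    define s where "s = (b (Suc i) - b i) / (a (Suc i) - a i)"
    define l where "l n = layer a i (u n)" for n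
    \<comment> \<open>An antiderivative of the line \<open>b i + s * x\<close> in the offset
      \<open>x\<close> from \<open>a i\<close>. Its increments are width times midpoint value, so a
      telescoping sum replaces the integral.\<close>
    define F where "F x = b i * x + s * x\<^sup>2 / 2" for x
    have s: "s \<ge> 0" using da b_mono[OF i] by (simp add: s_def)
    have "F (l (Suc n)) - F (l n) \<le> (l (Suc n) - l n) * v (Suc n)" if n: "n < N" for n
    proof (cases "l (Suc n) = l n")
      case True
      then show ?thesis by simp
    next
      case False
      have l: "l n \<le> l (Suc n)" using layer_mono a_mono i u_mono n by (simp add: l_def)
      \<comment> \<open>Below \<open>a i\<close> the offset \<open>u (Suc n) - a i\<close> would be
        negative while \<open>l (Suc n)\<close> is 0; a step that gains in the layer excludes
        this.\<close>
      have "a i < u (Suc n)"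
        using False l a_mono[OF i] u_mono[OF n] unfolding l_def layer_def by linarith
      then have "l (Suc n) \<le> u (Suc n) - a i" by (simp add: l_def layer_def)
      then have "s * l (Suc n) \<le> s * (u (Suc n) - a i)" using s by (rule mult_left_mono)
      moreover have "s * (u (Suc n) - a i) \<le> v (Suc n) - b i"
        using above_line[OF n i] da by (simp add: s_def field_simps)
      moreover have "s * ((l n + l (Suc n)) / 2) \<le> s * l (Suc n)"
        using s l by (intro mult_left_mono) auto
      ultimately have "b i + s * ((l n + l (Suc n)) / 2) \<le> v (Suc n)" by linarith
      then have "(l (Suc n) - l n) * (b i + s * ((l n + l (Suc n)) / 2))
          \<le> (l (Suc n) - l n) * v (Suc n)"
        using l by (intro mult_left_mono) auto
      moreover have "F (l (Suc n)) - F (l n) =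
          (l (Suc n) - l n) * (b i + s * ((l n + l (Suc n)) / 2))"
        by (simp add: F_def power2_eq_square field_simps)
      ultimately show ?thesis by simp
    qed
    then have "(\<Sum>n<N. F (l (Suc n)) - F (l n)) \<le> (\<Sum>n<N. (l (Suc n) - l n) * v (Suc n))"
      by (intro sum_mono) auto
    moreover have "(\<Sum>n<N. F (l (Suc n)) - F (l n)) = F (l N) - F (l 0)"
      by (rule sum_lessThan_telescope)
    moreover have "F (l N) - F (l 0) = (a (Suc i) - a i) * ((b i + b (Suc i)) / 2)"
    proof -
      have "s * (a (Suc i) - a i) = b (Suc i) - b i" using da by (simp add: s_def)
      then have "s * (a (Suc i) - a i)\<^sup>2 = (a (Suc i) - a i) * (b (Suc i) - b i)"
        by (simp add: power2_eq_square)
      then show ?thesis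
        unfolding l_def layer_ends[OF i] F_def by (simp add: field_simps)
    qed
    ultimately show ?thesis by (simp add: l_def)
  qed
  then have "(\<Sum>i<k. (a (Suc i) - a i) * ((b i + b (Suc i)) / 2))
      \<le> (\<Sum>i<k. \<Sum>n<N. (layer a i (u (Suc n)) - layer a i (u n)) * v (Suc n))"
    by (intro sum_mono) auto
  also have "\<dots> = (\<Sum>n<N. (u (Suc n) - u n) * v (Suc n))"
    using u_bounds by (rule sum_increments_conv_layers[symmetric])
  finally show ?thesis .
qed

end

section \<open>The polygon above the image of the set functions\<close>

text \<open>Maximality only speaks of supersets of \<open>P i\<close>. An arbitrary \<open>B\<close>
  is reached by uncrossing it with \<open>P i\<close>: the union falls under maximality, the
  intersection under the previous, steeper line.\<close>

lemma density_chain_supporting_line: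
  fixes f g :: "'a set \<Rightarrow> real" and P :: "nat \<Rightarrow> 'a set"
  assumes f: "mono_on (Pow S) f" "submodular_on S f" "f {} = 0"
      "\<And>A. A \<subseteq> S \<Longrightarrow> A \<noteq> {} \<Longrightarrow> f A > 0"
    and g: "mono_on (Pow S) g" "supermodular_on S g"
    and P: "P 0 = {}" "\<And>i. P i \<subseteq> P (Suc i)" "\<And>i. P i \<subseteq> S"
    and f_less: "\<And>i. i < k \<Longrightarrow> f (P i) < f (P (Suc i))"
    and density: "\<And>i C. i < k \<Longrightarrow> P i \<subseteq> C \<Longrightarrow> C \<subseteq> S \<Longrightarrow> f (P i) < f C \<Longrightarrow>
      (g C - g (P i)) / (f C - f (P i))
        \<le> (g (P (Suc i)) - g (P i)) / (f (P (Suc i)) - f (P i))"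
    and i: "i < k" and B: "B \<subseteq> S"
  shows "(g B - g (P i)) * (f (P (Suc i)) - f (P i))
    \<le> (g (P (Suc i)) - g (P i)) * (f B - f (P i))"
proof -
  define \<rho> where "\<rho> i = (g (P (Suc i)) - g (P i)) / (f (P (Suc i)) - f (P i))" for i
  have \<rho>_nonneg: "\<rho> i \<ge> 0" if "i < k" for i
    using f_less[OF that] mono_onD[OF g(1), of "P i" "P (Suc i)"] P by (simp add: \<rho>_def)
  have \<rho>_eq: "g (P (Suc i)) - g (P i) = \<rho> i * (f (P (Suc i)) - f (P i))" if "i < k" for i
    using f_less[OF that] by (simp add: \<rho>_def)
  have pos: "g C - g (P i) \<le> \<rho> i * (f C - f (P i))"
    if "i < k" "P i \<subseteq> C" "C \<subseteq> S" "f (P i) < f C" for i C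
    using density[OF that] that by (simp add: \<rho>_def[symmetric] field_simps)
  \<comment> \<open>Sets with \<open>f C = f (P i)\<close> are not covered by maximality at stage \<open>i\<close>, but by stage \<open>i - 1\<close>.\<close>
  have superset: "g C - g (P i) \<le> \<rho> i * (f C - f (P i))"
    if i: "i < k" and C: "P i \<subseteq> C" "C \<subseteq> S" for i C
  proof (cases "f (P i) < f C")
    case True
    then show ?thesis using pos that by blast
  next
    case False
    moreover have "f (P i) \<le> f C" using mono_onD[OF f(1), of "P i" C] C P by auto
    ultimately have eq: "f C = f (P i)" by simp
    have "g C \<le> g (P i)"
    proof (cases i)
      case 0
      then have "C = {}" using eq f(3) f(4)[of C] C P by fastforce
      then show ?thesis using 0 P by simp
    next
      case (Suc j)
      then have "j < k" using i by simp
      moreover have "P j \<subseteq> C" using P(2)[of j] C Suc by blast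
      ultimately have "g C - g (P j) \<le> \<rho> j * (f C - f (P j))"
        using pos[of j C] C f_less[of j] eq Suc by simp
      then show ?thesis using \<rho>_eq[of j] \<open>j < k\<close> eq Suc by simp
    qed
    then show ?thesis using eq by simp
  qed
  \<comment> \<open>The set \<open>P (Suc (Suc j))\<close> competes at stage \<open>j\<close>;
    cancelling the first increment leaves a comparison of the two slopes.\<close>
  have \<rho>_antimono: "\<rho> (Suc j) \<le> \<rho> j" if j: "Suc j < k" for j
  proof -
    have "g (P (Suc (Suc j))) - g (P j) \<le> \<rho> j * (f (P (Suc (Suc j))) - f (P j))"
      using superset[of j "P (Suc (Suc j))"] P(2)[of j] P(2)[of "Suc j"] P(3) j
      by (meson Suc_lessD order_trans)
    then have "\<rho> (Suc j) * (f (P (Suc (Suc j))) - f (P (Suc j)))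
        \<le> \<rho> j * (f (P (Suc (Suc j))) - f (P (Suc j)))"
      using \<rho>_eq[of j] \<rho>_eq[of "Suc j"] j by (simp add: algebra_simps)
    then show ?thesis using f_less[OF j] by simp
  qed
  \<comment> \<open>Equivalently, \<open>P i\<close> maximizes \<open>g - \<rho> i * f\<close> on
    all subsets of \<open>S\<close>. Quantifying over \<open>B\<close> lets the induction pass to an
    intersection.\<close>
  have "\<forall>B\<subseteq>S. g B - \<rho> i * f B \<le> g (P i) - \<rho> i * f (P i)" using i
  proof (induction i)
    case 0
    show ?case using superset[of 0] 0 P by (auto simp: algebra_simps)
  next
    case (Suc j)
    show ?case
    proof (intro allI impI)
      fix B assume B: "B \<subseteq> S"
      let ?h = "\<lambda>B. g B - \<rho> (Suc j) * f B" and ?Q = "P (Suc j)"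
      have 1: "?h (B \<union> ?Q) \<le> ?h ?Q"
        using superset[of "Suc j" "B \<union> ?Q"] Suc.prems B P by (simp add: algebra_simps)
      \<comment> \<open>With slope \<open>\<rho> j\<close> the sets \<open>P j\<close> and
        \<open>?Q\<close> have the same value. Lowering the slope to \<open>\<rho> (Suc j)\<close>
        favours \<open>?Q\<close>, whose \<open>f\<close> is the larger.\<close>
      have 2: "?h (B \<inter> ?Q) \<le> ?h ?Q"
      proof -
        have "g (B \<inter> ?Q) - \<rho> j * f (B \<inter> ?Q) \<le> g (P j) - \<rho> j * f (P j)"
          using Suc.IH[OF Suc_lessD[OF Suc.prems]] le_infI1[OF B] by blast
        also have "\<dots> = g ?Q - \<rho> j * f ?Q"
          using \<rho>_eq[of j] Suc.prems by (simp add: algebra_simps)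
        finally have "g (B \<inter> ?Q) - \<rho> j * f (B \<inter> ?Q) \<le> g ?Q - \<rho> j * f ?Q" .
        moreover have "(\<rho> j - \<rho> (Suc j)) * f (B \<inter> ?Q) \<le> (\<rho> j - \<rho> (Suc j)) * f ?Q"
          using \<rho>_antimono[OF Suc.prems] mono_onD[OF f(1), of "B \<inter> ?Q" ?Q] B P(3)
          by (intro mult_left_mono) auto
        ultimately show ?thesis by (simp add: algebra_simps)
      qed
      have 3: "\<rho> (Suc j) * (f (B \<union> ?Q) + f (B \<inter> ?Q)) \<le> \<rho> (Suc j) * (f B + f ?Q)"
        using f(2) B P(3) \<rho>_nonneg[OF Suc.prems]
        by (intro mult_left_mono) (auto simp: submodular_on_def)
      have 4: "g B + g ?Q \<le> g (B \<union> ?Q) + g (B \<inter> ?Q)"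
        using g(2) B P(3) by (auto simp: supermodular_on_def)
      \<comment> \<open>By 3 and 4, \<open>?h B + ?h ?Q\<close> is at most the sum of
        \<open>?h\<close> at union and intersection, hence at most \<open>2 * ?h ?Q\<close>.\<close>
      show "?h B \<le> ?h ?Q" using 1 2 3 4 by (simp add: algebra_simps)
    qed
  qed
  then have "g B - g (P i) \<le> \<rho> i * (f B - f (P i))" using B by (simp add: algebra_simps)
  then show ?thesis using f_less[OF i] by (simp add: \<rho>_def field_simps)
qed

section \<open>Searches\<close>

lemma searched_upto_nth:
  assumes "distinct \<pi>" "n < length \<pi>"
  shows "searched_upto \<pi> (\<pi> ! n) = set (take (Suc n) \<pi>)"
    and "set (take (Suc n) \<pi>) - {\<pi> ! n} = set (take n \<pi>)"
proof -
  have "precedes \<pi> x (\<pi> ! n) \<longleftrightarrow> x \<in> (!) \<pi> ` {0..<n}" for x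
  proof
    assume "precedes \<pi> x (\<pi> ! n)"
    then show "x \<in> (!) \<pi> ` {0..<n}"
      using assms by (auto simp: precedes_def nth_eq_iff_index_eq)
  next
    assume "x \<in> (!) \<pi> ` {0..<n}"
    then show "precedes \<pi> x (\<pi> ! n)"
      unfolding precedes_def using assms(2) by force
  qed
  then have "{x. precedes \<pi> x (\<pi> ! n)} = set (take n \<pi>)"
    using assms(2) nth_image[of n \<pi>] by auto
  moreover have "\<pi> ! n \<notin> set (take n \<pi>)"
    using assms by (auto simp: in_set_conv_nth nth_eq_iff_index_eq)
  ultimately show "searched_upto \<pi> (\<pi> ! n) = set (take (Suc n) \<pi>)"
    and "set (take (Suc n) \<pi>) - {\<pi> ! n} = set (take n \<pi>)"
    using assms by (auto simp: searched_upto_def take_Suc_conv_app_nth)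
qed

text \<open>Brings the cost into the form of the sliced sums, with \<open>u\<close> and
  \<open>v\<close> the values of \<open>g\<close> and \<open>f\<close> on prefixes.\<close>

lemma search_cost_conv_prefixes:
  assumes "\<pi> \<in> permutations_of_set S"
  shows "search_cost S f g \<pi> = (\<Sum>n<length \<pi>.
    (g (set (take (Suc n) \<pi>)) - g (set (take n \<pi>))) * f (set (take (Suc n) \<pi>)))"
proof -
  have \<pi>: "set \<pi> = S" "distinct \<pi>" using assms by (auto simp: permutations_of_set_def)
  have "bij_betw ((!) \<pi>) {..<length \<pi>} S" using \<pi> by (intro bij_betw_nth) auto
  then show ?thesis
    unfolding search_cost_def using \<pi>
    by (subst sum.reindex_bij_betw[symmetric]) (auto simp: searched_upto_nth)
qed

text \<open>If the element at position \<open>n\<close> lies in the union of the first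
  \<open>i\<close> blocks, everything outside that union comes later; otherwise the whole union has
  come before.\<close>

lemma respects_order_prefix:
  assumes \<pi>: "distinct \<pi>" "set \<pi> = \<Union>(set As)" and "respects_order \<pi> As"
    and n: "n < length \<pi>" and i: "i \<le> length As"
  shows "set (take (Suc n) \<pi>) \<subseteq> \<Union>(set (take i As)) \<or> \<Union>(set (take i As)) \<subseteq> set (take n \<pi>)"
proof -
  let ?P = "\<Union>(set (take i As))"
  have before: "precedes \<pi> x y" if xy: "x \<in> ?P" "y \<in> set \<pi>" "y \<notin> ?P" for x y
  proof -
    obtain j where j: "j < i" "x \<in> As ! j" using xy(1) by (auto simp: in_set_conv_nth)
    obtain l where l: "l < length As" "y \<in> As ! l"
      using xy(2) \<pi>(2) by (auto simp: in_set_conv_nth)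
    have "\<not> l < i"
    proof
      assume "l < i"
      then have "As ! l \<in> set (take i As)" using l(1) by (auto simp: in_set_conv_nth)
      then show False using xy(3) l(2) by blast
    qed
    then show ?thesis
      using \<open>respects_order \<pi> As\<close> j l unfolding respects_order_def by (meson leI less_le_trans)
  qed
  have asym: "\<not> precedes \<pi> y x" if "precedes \<pi> x y" for x y
    using that \<pi>(1) by (auto simp: precedes_def nth_eq_iff_index_eq)
  have upto: "x \<in> set (take (Suc n) \<pi>) \<longleftrightarrow> x = \<pi> ! n \<or> precedes \<pi> x (\<pi> ! n)"
    and upto': "x \<in> set (take n \<pi>) \<longleftrightarrow> (x = \<pi> ! n \<or> precedes \<pi> x (\<pi> ! n)) \<and> x \<noteq> \<pi> ! n" for x
    using searched_upto_nth[OF \<pi>(1) n] by (auto simp: searched_upto_def)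
  show ?thesis
  proof (cases "\<pi> ! n \<in> ?P")
    case True
    have "set (take (Suc n) \<pi>) \<subseteq> ?P"
    proof
      fix x assume x: "x \<in> set (take (Suc n) \<pi>)"
      then have "x \<in> set \<pi>" by (rule in_set_takeD)
      then show "x \<in> ?P" using x True before[of "\<pi> ! n" x] asym upto by metis
    qed
    then show ?thesis ..
  next
    case False
    then have "?P \<subseteq> set (take n \<pi>)" using before[of _ "\<pi> ! n"] n upto' by auto
    then show ?thesis ..
  qed
qed

section \<open>Comparing rectangles and trapezia for a decomposition\<close>

theorem mainTheorem3:
  fixes S :: "'a set" and f g :: "'a set \<Rightarrow> real" and As :: "'a set list" and \<pi> :: "'a list"
  assumes "finite S" and "S \<noteq> {}"
    and "f \<in> Pow S \<rightarrow> {0..}" and "mono_on (Pow S) f" and "submodular_on S f"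
    and "f {} = 0" and "\<And>A. A \<subseteq> S \<Longrightarrow> A \<noteq> {} \<Longrightarrow> f A > 0"
    and "g \<in> Pow S \<rightarrow> {0..}" and "mono_on (Pow S) g" and "supermodular_on S g"
    and "g {} = 0" and "\<And>A. A \<subseteq> S \<Longrightarrow> A \<noteq> S \<Longrightarrow> g A < g S"
    and "sidney_decomposition S f g As"
    and "\<pi> \<in> permutations_of_set S" and "respects_order \<pi> As"
  shows "search_cost S f g \<pi> \<le> 2 * Min (search_cost S f g ` permutations_of_set S)"
proof -
  \<comment> \<open>From \<open>i = length As\<close> on, \<open>P i\<close> stays equal to
    \<open>S\<close>, so monotonicity of the chain holds for every \<open>i\<close>.\<close>
  define P where "P i = \<Union>(set (take i As))" for i
  define k where "k = length As"
  have S: "\<Union>(set As) = S"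
    using assms(13) by (auto simp: sidney_decomposition_def partition_on_def)
  have P: "P 0 = {}" "P k = S" using S by (auto simp: P_def k_def)
  have P_Suc: "P (Suc i) = P i \<union> As ! i" if "i < k" for i
    using that by (auto simp: P_def k_def take_Suc_conv_app_nth)
  have P_mono: "P i \<subseteq> P (Suc i)" for i
    unfolding P_def by (intro Union_mono set_take_subset_set_take) simp
  have P_sub: "P i \<subseteq> S" for i
    unfolding P_def S[symmetric] by (intro Union_mono set_take_subset)
  have max: "max_density (S - P i) (contraction f (P i)) (contraction g (P i)) (As ! i)"
    if "i < k" for i
    using assms(13) that by (auto simp: sidney_decomposition_def P_def k_def Let_def)
  have f_less: "f (P i) < f (P (Suc i))" if "i < k" for i
    using max[OF that] P_Suc[OF that] by (simp add: max_density_def contraction_def)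
  \<comment> \<open>A density in the contracted problem is a slope between points of the image of
    \<open>(f, g)\<close>; the competitor is \<open>C - P i\<close>.\<close>
  have density: "(g C - g (P i)) / (f C - f (P i))
        \<le> (g (P (Suc i)) - g (P i)) / (f (P (Suc i)) - f (P i))"
    if i: "i < k" and C: "P i \<subseteq> C" "C \<subseteq> S" "f (P i) < f C" for i C
  proof -
    have C_eq: "P i \<union> (C - P i) = C" using C by blast
    have "C - P i \<subseteq> S - P i" "contraction f (P i) (C - P i) > 0"
      using C unfolding contraction_def C_eq by auto
    then have "contraction g (P i) (C - P i) / contraction f (P i) (C - P i)
        \<le> contraction g (P i) (As ! i) / contraction f (P i) (As ! i)"
      using max[OF i] unfolding max_density_def by blast
    then show ?thesis unfolding contraction_def C_eq P_Suc[OF i] .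
  qed
  note line = density_chain_supporting_line[OF assms(4-7,9,10) P(1) P_mono P_sub f_less density]
  have f_mono: "f A \<le> f B" and g_mono: "g A \<le> g B" if "A \<subseteq> B" "B \<subseteq> S" for A B
    using that mono_onD[OF assms(4), of A B] mono_onD[OF assms(9), of A B] by auto
  let ?a = "\<lambda>i. g (P i)" and ?b = "\<lambda>i. f (P i)"
  let ?u = "\<lambda>\<sigma> n. g (set (take n \<sigma>))" and ?v = "\<lambda>\<sigma> n. f (set (take n \<sigma>))"
  have a_mono: "?a i \<le> ?a (Suc i)" for i by (rule g_mono[OF P_mono P_sub])
  have b_mono: "?b i \<le> ?b (Suc i)" for i by (rule f_mono[OF P_mono P_sub])
  have sub: "set (take n \<sigma>) \<subseteq> S" if "\<sigma> \<in> permutations_of_set S" for \<sigma> n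
    using that set_take_subset[of n \<sigma>] by (auto simp: permutations_of_set_def)
  have u_mono: "?u \<sigma> n \<le> ?u \<sigma> (Suc n)" if "\<sigma> \<in> permutations_of_set S" for \<sigma> n
    by (intro g_mono sub that set_take_subset_set_take) simp
  have u_bounds: "?a 0 \<le> ?u \<sigma> n" "?u \<sigma> n \<le> ?a k" if "\<sigma> \<in> permutations_of_set S" for \<sigma> n
    using g_mono sub[OF that] P by auto
  have u_ends: "?u \<sigma> 0 = ?a 0" "?u \<sigma> (length \<sigma>) = ?a k" if "\<sigma> \<in> permutations_of_set S" for \<sigma>
    using that P by (auto simp: permutations_of_set_def)
  have "search_cost S f g \<pi> \<le> (\<Sum>i<k. (?a (Suc i) - ?a i) * ?b (Suc i))"
    unfolding search_cost_conv_prefixes[OF assms(14)]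
  proof (rule sum_increments_le_rectangles[where u = "?u \<pi>" and a = ?a and b = ?b and v = "?v \<pi>"])
    fix n i assume n: "n < length \<pi>" and i: "i < k" and less: "?u \<pi> n < ?a (Suc i)"
    \<comment> \<open>Otherwise monotonicity of \<open>g\<close> would lift
      \<open>?u \<pi> n\<close> to \<open>?a (Suc i)\<close>. The order of the blocks then leaves
      only the other alternative.\<close>
    have "\<not> P (Suc i) \<subseteq> set (take n \<pi>)"
      using less g_mono[of "P (Suc i)" "set (take n \<pi>)"] sub[OF assms(14)] by force
    then have "set (take (Suc n) \<pi>) \<subseteq> P (Suc i)"
      using respects_order_prefix[of \<pi> As n "Suc i"] assms(14,15) n i S
      by (auto simp: P_def k_def permutations_of_set_def)
    then show "?v \<pi> (Suc n) \<le> ?b (Suc i)" using f_mono P_sub by blast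
  qed (use a_mono u_mono u_bounds u_ends assms(14) in auto)
  also have "\<dots> \<le> (\<Sum>i<k. 2 * ((?a (Suc i) - ?a i) * ((?b i + ?b (Suc i)) / 2)))"
  proof (rule sum_mono)
    fix i
    \<comment> \<open>The factor 2 arises here: a rectangle of width \<open>?b (Suc i)\<close> is
      compared with twice the mean of \<open>?b i\<close> and \<open>?b (Suc i)\<close>.\<close>
    have "?b i \<ge> 0" using assms(3) P_sub[of i] by auto
    then have "(?a (Suc i) - ?a i) * ?b (Suc i) \<le> (?a (Suc i) - ?a i) * (?b i + ?b (Suc i))"
      using a_mono[of i] by (intro mult_left_mono) auto
    then show "(?a (Suc i) - ?a i) * ?b (Suc i)
        \<le> 2 * ((?a (Suc i) - ?a i) * ((?b i + ?b (Suc i)) / 2))" by simp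
  qed
  also have "\<dots> = 2 * (\<Sum>i<k. (?a (Suc i) - ?a i) * ((?b i + ?b (Suc i)) / 2))"
    by (simp only: sum_distrib_left)
  finally have upper: "search_cost S f g \<pi>
      \<le> 2 * (\<Sum>i<k. (?a (Suc i) - ?a i) * ((?b i + ?b (Suc i)) / 2))" .
  have lower: "(\<Sum>i<k. (?a (Suc i) - ?a i) * ((?b i + ?b (Suc i)) / 2)) \<le> search_cost S f g \<sigma>"
    if \<sigma>: "\<sigma> \<in> permutations_of_set S" for \<sigma>
    unfolding search_cost_conv_prefixes[OF \<sigma>]
    \<comment> \<open>The condition \<open>above_line\<close> is \<open>line\<close> applied to the
      prefix of length \<open>Suc n\<close>, which may be any subset of \<open>S\<close>.\<close>
    by (rule trapezia_le_sum_increments[where u = "?u \<sigma>" and a = ?a and b = ?b and v = "?v \<sigma>"])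
      (use line a_mono b_mono u_mono u_bounds u_ends sub \<sigma> in auto)
  have "Min (search_cost S f g ` permutations_of_set S) \<in> search_cost S f g ` permutations_of_set S"
    using assms(1) by (intro Min_in) auto
  then show ?thesis using upper lower by force
qed

end
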